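(* For every integer $n\geq 1$, the graph $G(L(Q_n))$ has a Hamiltonian cycle, where $Q_n$ denotes the $n$-dimensional hypercube.
   Context: The $n$-dimensional hypercube $Q_n$ is the convex hull of $\{0,1\}^n$. For a polytope $P$, its face lattice $L(P)$ is the set of all faces of $P$, including the empty face $\emptyset$ (of dimension $-1$) and $P$ itself, ordered by inclusion. The cover graph $G(L(P))$ has the faces of $P$ as vertices, and an edge between faces $F\subset F'$ whenever $\dim F'=\dim F+1$. (Equivalently for $Q_n$: the nonempty faces are encoded by strings in $\{0,1,-\}^n$, the face being the set of $0/1$-vectors obtained by replacing each $-$ by $0$ or $1$; the edges of $G(L(Q_n))$ join strings differing in replacing a single $0$ or $1$ by $-$, plus the edges between $\emptyset$ and every string in $\{0,1\}^n$.) *)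

theory Defs
  imports "HOL-Analysis.Analysis"
begin

definition hypercube :: "(real ^ 'n) set" where
  "hypercube = convex hull {x. \<forall>i. x $ i \<in> {0, 1}}"

(* The library relation "face_of" admits the empty face and P itself. *)
definition face_lattice :: "'a::euclidean_space set \<Rightarrow> 'a set set" where
  "face_lattice P = {F. F face_of P}"

(* Undirected edges are two-element vertex sets; aff_dim is integer-valued, with
   aff_dim {} = -1. *)
definition cover_edges :: "'a::euclidean_space set \<Rightarrow> 'a set set set" where
  "cover_edges P =
     {{F, F'} | F F'. F \<in> face_lattice P \<and> F' \<in> face_lattice P \<and>
        F \<subset> F' \<and> aff_dim F' = aff_dim F + 1}"

(* The list vs lists the vertices of the cycle once each; the closing edge joins its last
   element to its first. *)
definition hamiltonian_cycle :: "'v set \<Rightarrow> 'v set set \<Rightarrow> 'v list \<Rightarrow> bool" where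
  "hamiltonian_cycle V E vs \<longleftrightarrow>
     distinct vs \<and> set vs = V \<and> length vs \<ge> 3 \<and>
     (\<forall>i < length vs. {vs ! i, vs ! (Suc i mod length vs)} \<in> E)"

end

theory Submission
  imports Defs
begin

text \<open>
  Encode a nonempty face of the cube by its barycentre, a vector with entries in \<open>{0, 1/2, 1}\<close>
  (the entry \<open>1/2\<close> plays the role of the symbol \<open>-\<close>). Two faces are then in a cover
  relation iff their barycentres are neighbours in the grid \<open>{0, 1/2, 1}\<^sup>n\<close>. The reflected ternary
  Gray code is a Hamiltonian path of that grid from the corner \<open>(0,\<dots>,0)\<close> to the corner
  \<open>(1,\<dots>,1)\<close>, and the empty face, being adjacent to every vertex of the cube, closes it up.
\<close>

section \<open>A Hamiltonian path in the grid of barycentres\<close>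

text \<open>The parameter \<open>A\<close> collects the coordinates allowed to vary, so that the
  Gray code can be built by induction on \<open>A\<close> inside one fixed vector type.\<close>

definition grid :: "'n set \<Rightarrow> (real ^ 'n) set" where
  "grid A = {c. \<forall>i. c $ i \<in> {0, 1/2, 1} \<and> (i \<notin> A \<longrightarrow> c $ i = 0)}"

text \<open>Asking for an entry 1/2 rules out the jump between 0 and 1, which would join two faces
  of equal dimension.\<close>

definition grid_adj :: "real ^ 'n \<Rightarrow> real ^ 'n \<Rightarrow> bool" where
  "grid_adj c d \<longleftrightarrow>
     (\<exists>i. c $ i \<noteq> d $ i \<and> (c $ i = 1/2 \<or> d $ i = 1/2) \<and> (\<forall>j. j \<noteq> i \<longrightarrow> c $ j = d $ j))"

definition coord_upd :: "'n \<Rightarrow> real \<Rightarrow> real ^ 'n \<Rightarrow> real ^ 'n" where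
  "coord_upd a t c = (\<chi> i. if i = a then t else c $ i)"

lemma coord_upd_nth [simp]: "coord_upd a t c $ i = (if i = a then t else c $ i)"
  by (simp add: coord_upd_def)

lemma grid_adj_commute: "grid_adj c d \<longleftrightarrow> grid_adj d c"
  unfolding grid_adj_def by metis

lemma grid_adj_coord_upd:
  assumes "grid_adj c d" "c $ a = d $ a"
  shows "grid_adj (coord_upd a t c) (coord_upd a t d)"
proof -
  obtain i where i: "c $ i \<noteq> d $ i" "c $ i = 1/2 \<or> d $ i = 1/2" "\<forall>j. j \<noteq> i \<longrightarrow> c $ j = d $ j"
    using assms(1) by (auto simp: grid_adj_def)
  then have "i \<noteq> a"
    using assms(2) by auto
  with i show ?thesis
    unfolding grid_adj_def by (intro exI[of _ i]) auto
qed

lemma grid_adj_coord_upd_half: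
  assumes "s \<noteq> 1/2"
  shows "grid_adj (coord_upd a s c) (coord_upd a (1/2) c)"
  unfolding grid_adj_def using assms by (intro exI[of _ a]) auto

lemma grid_insert:
  "grid (insert a A) =
    grid A \<union> coord_upd a (1/2) ` grid A \<union> coord_upd a 1 ` grid A" (is "_ = ?R")
proof (intro equalityI subsetI)
  fix c assume c: "c \<in> grid (insert a A)"
  have "coord_upd a 0 c \<in> grid A"
    using c by (auto simp: grid_def)
  moreover have "c = coord_upd a (c $ a) (coord_upd a 0 c)"
    by (simp add: vec_eq_iff)
  moreover have "c $ a \<in> {0, 1/2, 1}"
    using c by (auto simp: grid_def)
  moreover have "coord_upd a 0 (coord_upd a 0 c) = coord_upd a 0 c"
    by (simp add: vec_eq_iff)
  ultimately show "c \<in> ?R"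
    by (metis UnI1 UnI2 empty_iff imageI insertE)
next
  fix c assume "c \<in> ?R"
  then obtain t d where *: "c = d \<or> c = coord_upd a t d" "t \<in> {1/2, 1}" "d \<in> grid A"
    by blast
  then have "c $ i = d $ i \<or> i = a \<and> c $ i = t" for i
    by (auto split: if_splits)
  with * show "c \<in> grid (insert a A)"
    unfolding grid_def mem_Collect_eq by (metis insert_iff)
qed

text \<open>Three copies of the path for \<open>A\<close> are traversed forwards, backwards,
  forwards. The number of copies being odd, the path ends where the last forward copy ends, which
  keeps both endpoints at 0/1 corners throughout the induction.\<close>

lemma grid_hamiltonian_path:
  fixes A :: "'n::finite set"
  shows "\<exists>cs. distinct cs \<and> set cs = grid A \<and> cs \<noteq> [] \<and> successively grid_adj cs
    \<and> hd cs = 0 \<and> last cs = (\<chi> i. if i \<in> A then 1 else 0)"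
  using finite[of A]
proof (induction A rule: finite_induct)
  case empty
  have "grid ({} :: 'n set) = {0}"
    by (auto simp: grid_def vec_eq_iff)
  then show ?case
    by (intro exI[of _ "[0]"]) (simp add: vec_eq_iff)
next
  case (insert a A)
  then obtain cs where cs: "distinct cs" "set cs = grid A" "cs \<noteq> []"
    "successively grid_adj cs" "hd cs = 0" "last cs = (\<chi> i. if i \<in> A then 1 else 0)"
    by blast
  have zero: "c $ a = 0" if "c \<in> set cs" for c
    using that cs(2) insert.hyps by (auto simp: grid_def)
  then have upd0: "coord_upd a 0 c = c" if "c \<in> set cs" for c
    using that by (simp add: vec_eq_iff)
  let ?f = "coord_upd a (1/2)" and ?g = "coord_upd a 1"
  \<comment> \<open>The layers with entry 0, 1/2, 1 at \<open>a\<close>; reversing the middle one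
    makes each junction change coordinate \<open>a\<close> only.\<close>
  let ?ds = "cs @ map ?f (rev cs) @ map ?g cs"
  have inj: "inj_on (coord_upd a t) (set cs)" for t
    by (rule inj_on_inverseI[where g = "coord_upd a 0"]) (use zero in \<open>auto simp: vec_eq_iff\<close>)
  have "coord_upd a s ` set cs \<inter> coord_upd a t ` set cs = {}" if "s \<noteq> t" for s t
  proof -
    have "c $ a = t" if "c \<in> coord_upd a t ` set cs" for c t
      using that by auto
    then show ?thesis
      using that by (metis disjoint_iff)
  qed
  from this[of 0 "1/2"] this[of 0 1] this[of "1/2" 1]
  have disj: "set cs \<inter> ?f ` set cs = {}" "set cs \<inter> ?g ` set cs = {}"
    "?f ` set cs \<inter> ?g ` set cs = {}"
    using upd0 by simp_all
  have succ: "successively (\<lambda>c d. grid_adj (coord_upd a t c) (coord_upd a t d)) cs" for t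
    by (rule successively_mono[OF cs(4)]) (simp add: grid_adj_coord_upd zero)
  \<comment> \<open>The junctions lie over \<open>last cs\<close> (from 0 to 1/2) and over
    \<open>hd cs\<close> (from 1/2 to 1).\<close>
  have "successively grid_adj ?ds"
    using cs(3,4) succ[of "1/2"] succ[of 1] grid_adj_coord_upd_half[of 0 a "last cs"]
      grid_adj_coord_upd_half[of 1 a "hd cs"] upd0[of "last cs"]
    by (simp add: successively_append_iff successively_map successively_rev hd_map last_map
        hd_rev last_rev grid_adj_commute)
  moreover have "distinct ?ds"
    using cs(1) inj disj by (simp add: distinct_map Int_Un_distrib)
  moreover have "set ?ds = grid (insert a A)"
    using grid_insert[of a A] cs(2) by auto
  moreover have "last ?ds = (\<chi> i. if i \<in> insert a A then 1 else 0)"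
    using cs(3,6) by (auto simp: last_map vec_eq_iff)
  moreover have "?ds \<noteq> []" "hd ?ds = 0"
    using cs(3,5) by simp_all
  ultimately show ?case
    by blast
qed

section \<open>The faces of the cube\<close>

text \<open>Describing the face by coordinates rather than as a hull of vertices makes membership an
  entrywise check.\<close>

definition cube_face :: "real ^ 'n \<Rightarrow> (real ^ 'n) set" where
  "cube_face c = {x. \<forall>i. 0 \<le> x $ i \<and> x $ i \<le> 1 \<and> (c $ i \<noteq> 1/2 \<longrightarrow> x $ i = c $ i)}"

lemma hypercube_eq_unit_box:
  "(hypercube :: (real ^ 'n::finite) set) = {x. \<forall>i. 0 \<le> x $ i \<and> x $ i \<le> 1}"
proof -
  have "{x :: real ^ 'n. \<forall>i. x $ i \<in> {0, 1}} = {x. \<forall>i\<in>Basis. x \<bullet> i = 0 \<or> x \<bullet> i = 1}"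
    by (auto simp: Basis_vec_def inner_axis)
  then have "hypercube = cbox (0 :: real ^ 'n) 1"
    by (simp add: hypercube_def unit_interval_convex_hull Cart_1)
  then show ?thesis
    by (simp add: set_eq_iff mem_box_cart)
qed

lemma convex_cube_face: "convex (cube_face c)"
proof (rule convexI)
  fix x y u v assume *: "x \<in> cube_face c" "y \<in> cube_face c" "0 \<le> u" "0 \<le> v" "u + v = (1::real)"
  show "u *\<^sub>R x + v *\<^sub>R y \<in> cube_face c"
    unfolding cube_face_def
  proof safe
    fix i
    show "0 \<le> (u *\<^sub>R x + v *\<^sub>R y) $ i"
      using * by (simp add: cube_face_def)
    show "(u *\<^sub>R x + v *\<^sub>R y) $ i \<le> 1"
      using * by (simp add: cube_face_def convex_bound_le)
    show "(u *\<^sub>R x + v *\<^sub>R y) $ i = c $ i" if "c $ i \<noteq> 1/2"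
      using * that by (simp add: cube_face_def flip: distrib_right)
  qed
qed

text \<open>The values 0 and 1 are extreme in the unit interval: a proper convex combination attains
  one of them only if both of its points do.\<close>

lemma cube_face_face_of_hypercube:
  fixes c :: "real ^ 'n::finite"
  assumes "c \<in> grid UNIV"
  shows "cube_face c face_of hypercube"
  unfolding face_of_def
proof (intro conjI ballI impI convex_cube_face)
  show "cube_face c \<subseteq> hypercube"
    by (auto simp: cube_face_def hypercube_eq_unit_box)
  fix a b x :: "real ^ 'n"
  assume a: "a \<in> hypercube" and b: "b \<in> hypercube" and x: "x \<in> cube_face c"
    and "x \<in> open_segment a b"
  then obtain u where u: "0 < u" "u < 1" "x = (1 - u) *\<^sub>R a + u *\<^sub>R b"
    by (auto simp: in_segment)
  have eq: "a $ i = c $ i \<and> b $ i = c $ i" if i: "c $ i \<noteq> 1/2" for i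
  proof -
    have xi: "c $ i = (1 - u) * a $ i + u * b $ i"
      using x u i by (auto simp: cube_face_def)
    have ai: "0 \<le> a $ i" "a $ i \<le> 1" and bi: "0 \<le> b $ i" "b $ i \<le> 1"
      using a b by (auto simp: hypercube_eq_unit_box)
    consider "c $ i = 0" | "c $ i = 1"
      using assms i by (auto simp: grid_def)
    then show ?thesis
    proof cases
      case 1
      then have "(1 - u) * a $ i = 0 \<and> u * b $ i = 0"
        using xi u ai bi by (simp add: add_nonneg_eq_0_iff)
      then show ?thesis
        using 1 u by auto
    next
      case 2
      \<comment> \<open>Passing to the complements \<open>1 - a $ i\<close> and
        \<open>1 - b $ i\<close> again gives nonnegative summands with sum 0.\<close>
      then have "(1 - u) * (1 - a $ i) + u * (1 - b $ i) = 0"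
        using xi by (simp add: algebra_simps)
      then have "(1 - u) * (1 - a $ i) = 0 \<and> u * (1 - b $ i) = 0"
        using u ai bi by (simp add: add_nonneg_eq_0_iff)
      then show ?thesis
        using 2 u by auto
    qed
  qed
  show "a \<in> cube_face c" "b \<in> cube_face c"
    using a b eq by (auto simp: cube_face_def hypercube_eq_unit_box)
qed

text \<open>The free entries of \<open>x\<close> lie strictly between 0 and 1, so a small step away
  from \<open>y\<close> keeps them there; the fixed entries do not move at all. Finitely many
  coordinates allow a common step size.\<close>

lemma cube_face_extend_segment:
  fixes x y c :: "real ^ 'n::finite"
  assumes x: "x \<in> cube_face c" "\<And>i. c $ i = 1/2 \<Longrightarrow> 0 < x $ i \<and> x $ i < 1"
    and y: "y \<in> cube_face c"
  shows "\<exists>e>0. x + e *\<^sub>R (x - y) \<in> cube_face c"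
proof -
  have "\<forall>\<^sub>F e in at_right 0. 0 \<le> x $ i + e * (x $ i - y $ i) \<and> x $ i + e * (x $ i - y $ i) \<le> 1" for i
  proof (cases "c $ i = 1/2")
    case True
    have "((\<lambda>e. x $ i + e * (x $ i - y $ i)) \<longlongrightarrow> x $ i + 0 * (x $ i - y $ i)) (at_right 0)"
      by (intro tendsto_intros)
    then have lim: "((\<lambda>e. x $ i + e * (x $ i - y $ i)) \<longlongrightarrow> x $ i) (at_right 0)"
      by simp
    show ?thesis
      using order_tendstoD(1)[OF lim, of 0] order_tendstoD(2)[OF lim, of 1] x(2)[OF True]
      by (auto elim: eventually_elim2)
  next
    case False
    then show ?thesis
      using x(1) y by (auto simp: cube_face_def)
  qed
  then have "\<forall>\<^sub>F e in at_right 0. \<forall>i. 0 \<le> x $ i + e * (x $ i - y $ i) \<and> x $ i + e * (x $ i - y $ i) \<le> 1"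
    by (rule eventually_all_finite)
  then have "\<forall>\<^sub>F e in at_right 0. e > 0 \<and>
      (\<forall>i. 0 \<le> x $ i + e * (x $ i - y $ i) \<and> x $ i + e * (x $ i - y $ i) \<le> 1)"
    using eventually_at_right_less by (rule eventually_elim2) auto
  then obtain e where "e > 0"
    "\<And>i. 0 \<le> x $ i + e * (x $ i - y $ i) \<and> x $ i + e * (x $ i - y $ i) \<le> 1"
    by (auto dest: eventually_happens)
  moreover have "x $ i + e * (x $ i - y $ i) = c $ i" if "c $ i \<noteq> 1/2" for i
    using x(1) y that by (auto simp: cube_face_def)
  ultimately show ?thesis
    by (auto simp: cube_face_def)
qed

text \<open>A relative interior point \<open>x\<close> of \<open>F\<close> determines the face: its
  entries 0 and 1 are the fixed ones. Any \<open>y\<close> in the resulting cube face starts a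
  segment through \<open>x\<close> that continues beyond it within the cube, so the face property
  puts \<open>y\<close> into \<open>F\<close>.\<close>

lemma face_of_hypercube_is_cube_face:
  fixes F :: "(real ^ 'n::finite) set"
  assumes F: "F face_of hypercube" "F \<noteq> {}"
  shows "\<exists>c\<in>grid UNIV. F = cube_face c"
proof -
  obtain x where x: "x \<in> rel_interior F"
    using F rel_interior_eq_empty face_of_imp_convex by blast
  then have xF: "x \<in> F"
    using rel_interior_subset by blast
  then have x01: "0 \<le> x $ i" "x $ i \<le> 1" for i
    using face_of_imp_subset[OF F(1)] by (auto simp: hypercube_eq_unit_box)
  define c :: "real ^ 'n" where "c = (\<chi> i. if x $ i \<in> {0, 1} then x $ i else 1/2)"
  have c: "c \<in> grid UNIV"
    by (auto simp: grid_def c_def)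
  have xc: "x \<in> cube_face c"
    using x01 by (auto simp: cube_face_def c_def)
  have pos: "0 < x $ i \<and> x $ i < 1" if "c $ i = 1/2" for i
    using that x01[of i] by (auto simp: c_def less_le split: if_splits)
  \<comment> \<open>A face of the cube that meets the relative interior of a subset contains that
    whole subset.\<close>
  have "F \<subseteq> cube_face c"
    by (rule subset_of_face_of[OF cube_face_face_of_hypercube[OF c] face_of_imp_subset[OF F(1)]])
      (use x xc in blast)
  moreover have "y \<in> F" if y: "y \<in> cube_face c" for y
  proof (cases "y = x")
    case False
    obtain e where e: "e > 0" "x + e *\<^sub>R (x - y) \<in> cube_face c" (is "?z \<in> _")
      using cube_face_extend_segment[OF xc pos y] by blast
    have "1 - 1 / (1 + e) = e / (1 + e)"
      using e(1) by (simp add: field_simps)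
    moreover have "x $ i = e / (1 + e) * y $ i + 1 / (1 + e) * ?z $ i" for i
      using e(1) by (simp add: algebra_simps flip: add_divide_distrib) (simp add: field_simps)
    \<comment> \<open>The weight \<open>1 / (1 + e)\<close> comes from solving
      \<open>?z = x + e *\<^sub>R (x - y)\<close> for \<open>x\<close>.\<close>
    ultimately have "x = (1 - 1 / (1 + e)) *\<^sub>R y + (1 / (1 + e)) *\<^sub>R ?z"
      by (simp add: vec_eq_iff)
    moreover have "y \<noteq> ?z"
    proof
      assume "y = ?z"
      then have "(1 + e) *\<^sub>R (x - y) = 0"
        by (simp add: algebra_simps)
      then show False
        using e(1) False by simp
    qed
    moreover have "0 < 1 / (1 + e)" "1 / (1 + e) < 1"
      using e(1) by auto
    ultimately have "x \<in> open_segment y ?z"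
      unfolding in_segment by blast
    moreover have "cube_face c \<subseteq> hypercube"
      using cube_face_face_of_hypercube[OF c] face_of_imp_subset by blast
    ultimately show ?thesis
      using face_ofD[OF F(1)] xF y e(2) by blast
  qed (simp add: xF)
  ultimately show ?thesis
    using c by blast
qed

lemma centre_in_cube_face:
  assumes "c \<in> grid UNIV"
  shows "c \<in> cube_face c"
proof -
  have "0 \<le> c $ i \<and> c $ i \<le> 1" for i
  proof -
    have "c $ i \<in> {0, 1/2, 1}"
      using assms by (simp add: grid_def)
    then show ?thesis
      by auto
  qed
  then show ?thesis
    by (simp add: cube_face_def)
qed

lemma face_lattice_hypercube:
  "face_lattice (hypercube :: (real ^ 'n::finite) set) = insert {} (cube_face ` grid UNIV)"
  unfolding face_lattice_def
  using cube_face_face_of_hypercube face_of_hypercube_is_cube_face by blast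

text \<open>Each centre lies in the other face, so an entry fixed by either centre agrees with that
  of the other; the remaining entries are 1/2 in both.\<close>

lemma inj_on_cube_face: "inj_on cube_face (grid UNIV)"
proof (rule inj_onI)
  fix c d :: "real ^ 'a"
  assume "c \<in> grid UNIV" "d \<in> grid UNIV" "cube_face c = cube_face d"
  then have "c \<in> cube_face d" "d \<in> cube_face c"
    using centre_in_cube_face by auto
  then show "c = d"
    unfolding cube_face_def vec_eq_iff mem_Collect_eq by metis
qed

lemma cube_face_vertex:
  assumes "\<And>i. c $ i \<in> {0, 1}"
  shows "cube_face c = {c}"
proof -
  have "c $ i \<noteq> 1/2 \<and> 0 \<le> c $ i \<and> c $ i \<le> 1" for i
    using assms[of i] by auto
  then show ?thesis
    by (auto simp: cube_face_def vec_eq_iff)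
qed

text \<open>The dimension grows because the smaller set is a proper face of the larger, and by at
  most one because adjoining the single point \<open>d\<close> already spans the larger one.\<close>

lemma aff_dim_cube_face_half:
  fixes c d :: "real ^ 'n::finite"
  assumes c: "c \<in> grid UNIV" and d: "d \<in> grid UNIV"
    and i: "c $ i \<noteq> d $ i" "d $ i = 1/2" and j: "\<And>j. j \<noteq> i \<Longrightarrow> c $ j = d $ j"
  shows "cube_face c \<subset> cube_face d" "aff_dim (cube_face d) = aff_dim (cube_face c) + 1"
proof -
  have "c $ k = d $ k" if "d $ k \<noteq> 1/2" for k
    using that i j by metis
  then have "x \<in> cube_face d" if "x \<in> cube_face c" for x
    using that by (auto simp: cube_face_def)
  moreover have "d \<in> cube_face d" "d \<notin> cube_face c"
    using centre_in_cube_face[OF d] i by (auto simp: cube_face_def)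
  ultimately show sub: "cube_face c \<subset> cube_face d"
    by blast
  have "cube_face c face_of cube_face d"
    by (rule face_of_subset[OF cube_face_face_of_hypercube[OF c]])
      (use sub cube_face_face_of_hypercube[OF d] face_of_imp_subset in auto)
  then have less: "aff_dim (cube_face c) < aff_dim (cube_face d)"
    using face_of_aff_dim_lt[OF convex_cube_face] sub by blast
  have "cube_face d \<subseteq> affine hull (insert d (cube_face c))"
  proof
    fix y assume y: "y \<in> cube_face d"
    let ?H = "affine hull (insert d (cube_face c))"
    have ci: "0 \<le> c $ i" "c $ i \<le> 1"
      using centre_in_cube_face[OF c] by (auto simp: cube_face_def)
    have "coord_upd i (c $ i) y \<in> cube_face c"
      using y ci j by (auto simp: cube_face_def)
    moreover have "c \<in> cube_face c"
      by (rule centre_in_cube_face[OF c])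
    \<comment> \<open>The vector \<open>d - c\<close> vanishes outside coordinate \<open>i\<close>,
      so a multiple of it restores the entry \<open>y $ i\<close> that the projection to
      \<open>cube_face c\<close> replaced.\<close>
    ultimately have "coord_upd i (c $ i) y + ((y $ i - c $ i) / (d $ i - c $ i)) *\<^sub>R (d - c) \<in> ?H"
      by (intro mem_affine_3_minus) (auto intro: hull_inc)
    also have "coord_upd i (c $ i) y + ((y $ i - c $ i) / (d $ i - c $ i)) *\<^sub>R (d - c) = y"
      using i j by (simp add: vec_eq_iff)
    finally show "y \<in> ?H" .
  qed
  then have "aff_dim (cube_face d) \<le> aff_dim (insert d (cube_face c))"
    using aff_dim_subset aff_dim_affine_hull by metis
  then show "aff_dim (cube_face d) = aff_dim (cube_face c) + 1"
    using less by (simp add: aff_dim_insert split: if_splits)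
qed

section \<open>The Hamiltonian cycle\<close>

lemma cover_edgesI:
  assumes "F \<in> face_lattice P" "F' \<in> face_lattice P" "F \<subset> F'" "aff_dim F' = aff_dim F + 1"
  shows "{F, F'} \<in> cover_edges P"
  using assms unfolding cover_edges_def by blast

text \<open>Edges are unordered, so whichever centre carries the entry 1/2 can be taken as that of
  the larger face.\<close>

lemma cover_edges_if_grid_adj:
  fixes c d :: "real ^ 'n::finite"
  assumes "c \<in> grid UNIV" "d \<in> grid UNIV" "grid_adj c d"
  shows "{cube_face c, cube_face d} \<in> cover_edges (hypercube :: (real ^ 'n) set)"
proof -
  have half: "{cube_face a, cube_face b} \<in> cover_edges (hypercube :: (real ^ 'n) set)"
    if "a \<in> grid UNIV" "b \<in> grid UNIV" "a $ i \<noteq> b $ i" "b $ i = 1/2"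
      "\<And>j. j \<noteq> i \<Longrightarrow> a $ j = b $ j" for a b :: "real ^ 'n" and i
    using aff_dim_cube_face_half[OF that] that
    by (intro cover_edgesI) (auto simp: face_lattice_hypercube)
  obtain i where i: "c $ i \<noteq> d $ i" "c $ i = 1/2 \<or> d $ i = 1/2" "\<And>j. j \<noteq> i \<Longrightarrow> c $ j = d $ j"
    using assms(3) by (auto simp: grid_adj_def)
  from i(2) show ?thesis
  proof
    assume "d $ i = 1/2"
    then show ?thesis
      using half[of c d i] assms i by auto
  next
    assume "c $ i = 1/2"
    then show ?thesis
      using half[of d c i] assms i by (auto simp: insert_commute)
  qed
qed

text \<open>The face is a single point, of dimension 0, one above the dimension -1 of the empty
  face.\<close>

lemma cover_edges_empty_vertex:
  fixes c :: "real ^ 'n::finite"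
  assumes "\<And>i. c $ i \<in> {0, 1}"
  shows "{{}, cube_face c} \<in> cover_edges (hypercube :: (real ^ 'n) set)"
proof (rule cover_edgesI)
  have "c \<in> grid UNIV"
    using assms by (auto simp: grid_def)
  then show "cube_face c \<in> face_lattice hypercube"
    by (simp add: face_lattice_hypercube)
qed (auto simp: face_lattice_hypercube cube_face_vertex[OF assms])

lemma hamiltonian_cycle_Cons:
  assumes "distinct (v # ws)" "length ws \<ge> 2" "successively (\<lambda>x y. {x, y} \<in> E) ws"
    "{v, hd ws} \<in> E" "{v, last ws} \<in> E"
  shows "hamiltonian_cycle (set (v # ws)) E (v # ws)"
  unfolding hamiltonian_cycle_def
proof (intro conjI allI impI)
  fix i assume i: "i < length (v # ws)"
  have ne: "ws \<noteq> []"
    using assms(2) by auto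
  \<comment> \<open>The edge leaving \<open>v\<close>, the edges inside \<open>ws\<close>, and the
    closing edge, where the index modulo the length wraps to 0.\<close>
  consider "i = 0" | k where "i = Suc k" "Suc k < length ws" | "i = length ws" "i > 0"
    using i ne by (cases i) (auto simp: less_Suc_eq)
  then show "{(v # ws) ! i, (v # ws) ! (Suc i mod length (v # ws))} \<in> E"
  proof cases
    case 1
    then show ?thesis
      using assms(2,4) ne by (simp add: hd_conv_nth)
  next
    case 2
    then show ?thesis
      using assms(3) by (simp add: successively_conv_nth)
  next
    case 3
    then show ?thesis
      using assms(5) ne by (simp add: last_conv_nth nth_Cons' insert_commute)
  qed
qed (use assms in auto)

theorem theorem5:
  shows "\<exists>vs. hamiltonian_cycle
           (face_lattice (hypercube :: (real ^ 'n::finite) set))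
           (cover_edges (hypercube :: (real ^ 'n::finite) set)) vs"
proof -
  let ?E = "cover_edges (hypercube :: (real ^ 'n) set)"
  obtain cs :: "(real ^ 'n) list" where cs: "distinct cs" "set cs = grid UNIV" "cs \<noteq> []"
    "successively grid_adj cs" "hd cs = 0" "last cs = (\<chi> i. 1)"
    using grid_hamiltonian_path[of "UNIV :: 'n set"] by auto
  let ?ws = "map cube_face cs"
  have ne: "{} \<notin> set ?ws"
    using cs(2) centre_in_cube_face by fastforce
  have "distinct ({} # ?ws)"
    using cs(1,2) inj_on_cube_face ne by (simp add: distinct_map)
  \<comment> \<open>The path has distinct endpoints, the all-zero and the all-one vector, since the
    index type is nonempty.\<close>
  moreover have "length ?ws \<ge> 2"
    using cs(3,5,6) by (cases cs rule: remdups_adj.cases) (auto simp: vec_eq_iff)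
  moreover have "successively (\<lambda>F F'. {F, F'} \<in> ?E) ?ws"
    unfolding successively_map
    by (rule successively_mono[OF cs(4)]) (use cs(2) cover_edges_if_grid_adj in auto)
  moreover have "{{}, hd ?ws} \<in> ?E" "{{}, last ?ws} \<in> ?E"
    using cs(3,5,6) by (simp_all add: hd_map last_map cover_edges_empty_vertex)
  ultimately have "hamiltonian_cycle (set ({} # ?ws)) ?E ({} # ?ws)"
    by (rule hamiltonian_cycle_Cons)
  moreover have "set ({} # ?ws) = face_lattice hypercube"
    by (simp add: face_lattice_hypercube cs(2))
  ultimately show ?thesis
    by metis
qed

end
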